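(* Let $(X,L,\tau,l)$ be a labelled Markov chain and $x,y\in X$. For every real $\delta>0$ there exist $\varepsilon\in[0,1]\cap\mathbb{Q}$ and a proof tree built from the rules (zero), (symm), (weak), (lab), (exp) with $x\mathrel{\#_{\varepsilon}}y$ at the root such that $0\le\mathsf{bd}(x,y)-\varepsilon<\delta$.
   Context: A labelled Markov chain (LMC) $(X,L,\tau,l)$ consists of a set of states $X$, a non-empty set of labels $L$, a transition function $\tau\colon X\to\mathcal{D}_{\mathbb{Q}}(X)$ where $\mathcal{D}_{\mathbb{Q}}(X)$ is the set of finitely supported distributions $\mu\colon X\to[0,1]\cap\mathbb{Q}$ with $\sum_x\mu(x)=1$, and a labelling $l\colon X\to L$. For a distribution $\mu$ and a function $h$ defined on a set containing $\operatorname{supp}(\mu)$, $\mu\models h:=\sum_{z\in\operatorname{supp}(\mu)}\mu(z)h(z)$. Let $\mathrm{PMet}_X$ be the set of pseudometrics $d\colon X\times X\to[0,1]$, ordered pointwise, with least element the constant-zero pseudometric; $d_e$ is the Euclidean distance on $[0,1]$. Define $\Gamma\colon\mathrm{PMet}_X\to\mathrm{PMet}_X$ by $\Gamma(d)(x,y)=1$ if $l(x)\neq l(y)$, and otherwise $\Gamma(d)(x,y)=\sup_{h}\big(\tau(x)\models h-\tau(y)\models h\big)$, the supremum over non-expansive maps $h\colon(X,d)\to([0,1],d_e)$ (i.e. $|h(u)-h(v)|\le d(u,v)$). The behavioural distance $\mathsf{bd}$ is the least fixed point of $\Gamma$. Derivation rules, with judgments $x\mathrel{\#_{\varepsilon}}y$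 for $x,y\in X$, $\varepsilon\in[0,1]\cap\mathbb{Q}$, and $\mathcal{S}=\mathcal{S}_{x,y}:=\operatorname{supp}(\tau(x))\cup\operatorname{supp}(\tau(y))$: (zero): $x\mathrel{\#_0}y$ with no premises. (symm): from $y\mathrel{\#_{\varepsilon}}x$ infer $x\mathrel{\#_{\varepsilon}}y$. (weak): from $x\mathrel{\#_{\varepsilon'}}y$ and $\varepsilon\le\varepsilon'$ infer $x\mathrel{\#_{\varepsilon}}y$. (lab): if $l(x)\neq l(y)$ infer $x\mathrel{\#_1}y$. (exp): given a map $h\colon\mathcal{S}\to[0,1]\cap\mathbb{Q}$, proofs of $x'\mathrel{\#_{h(x')-h(y')}}y'$ for all $x',y'\in\mathcal{S}$ with $h(x')>h(y')$, and $\tau(x)\models h-\tau(y)\models h\ge\varepsilon$, infer $x\mathrel{\#_{\varepsilon}}y$. Proof trees are finite trees built from these rules. *)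

theory Defs
  imports "HOL-Probability.Probability_Mass_Function"
begin

text \<open>A labelled Markov chain is given by a transition function \<open>\<tau> :: 'x \<Rightarrow> 'x pmf\<close> with values in
  \<open>rational_dists\<close> and a labelling \<open>l :: 'x \<Rightarrow> 'l\<close>; the sets of states and labels are the types
  \<open>'x\<close> and \<open>'l\<close>.\<close>

definition rat01 :: "real set" where
  "rat01 = {0..1} \<inter> \<rat>"

definition rational_dists :: "'x pmf set" where
  "rational_dists = {\<mu>. finite (set_pmf \<mu>) \<and> (\<forall>z. pmf \<mu> z \<in> \<rat>)}"

definition expect :: "'x pmf \<Rightarrow> ('x \<Rightarrow> real) \<Rightarrow> real"  (infix "\<Turnstile>" 70) where
  "\<mu> \<Turnstile> h = (\<Sum>z\<in>set_pmf \<mu>. pmf \<mu> z * h z)"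

definition PMet :: "('x \<Rightarrow> 'x \<Rightarrow> real) set" where
  "PMet = {d. (\<forall>x y. d x y \<in> {0..1}) \<and> (\<forall>x. d x x = 0) \<and> (\<forall>x y. d x y = d y x) \<and>
              (\<forall>x y z. d x z \<le> d x y + d y z)}"

definition nonexpansive :: "('x \<Rightarrow> 'x \<Rightarrow> real) \<Rightarrow> ('x \<Rightarrow> real) set" where
  "nonexpansive d = {h. (\<forall>u. h u \<in> {0..1}) \<and> (\<forall>u v. \<bar>h u - h v\<bar> \<le> d u v)}"

definition \<Gamma> ::
  "('x \<Rightarrow> 'x pmf) \<Rightarrow> ('x \<Rightarrow> 'l) \<Rightarrow> ('x \<Rightarrow> 'x \<Rightarrow> real) \<Rightarrow> 'x \<Rightarrow> 'x \<Rightarrow> real" where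
  "\<Gamma> \<tau> l d x y = (if l x \<noteq> l y then 1 else (SUP h\<in>nonexpansive d. \<tau> x \<Turnstile> h - \<tau> y \<Turnstile> h))"

text \<open>\<open>LEAST\<close> refers to the pointwise order on functions.\<close>

definition bd :: "('x \<Rightarrow> 'x pmf) \<Rightarrow> ('x \<Rightarrow> 'l) \<Rightarrow> 'x \<Rightarrow> 'x \<Rightarrow> real" where
  "bd \<tau> l = (LEAST d. d \<in> PMet \<and> \<Gamma> \<tau> l d = d)"

text \<open>\<open>Apart x \<epsilon> y\<close> represents \<open>x #\<^sub>\<epsilon> y\<close>. Its index is only constrained to \<open>rat01\<close> by the rules.\<close>

datatype 'x apartness = Apart 'x real 'x

text \<open>\<open>pf_rule \<tau> l P j\<close> states that the set \<open>P\<close> of premises and the conclusion \<open>j\<close> form an instance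
  of a derivation rule. A map \<open>h\<close> on \<open>S\<close> is represented by a total function of which only the values
  on \<open>S\<close> matter.\<close>

inductive pf_rule ::
  "('x \<Rightarrow> 'x pmf) \<Rightarrow> ('x \<Rightarrow> 'l) \<Rightarrow> 'x apartness set \<Rightarrow> 'x apartness \<Rightarrow> bool"
  for \<tau> :: "'x \<Rightarrow> 'x pmf" and l :: "'x \<Rightarrow> 'l" where
  Zero: "pf_rule \<tau> l {} (Apart x 0 y)"
| Symm: "\<epsilon> \<in> rat01 \<Longrightarrow> pf_rule \<tau> l {Apart y \<epsilon> x} (Apart x \<epsilon> y)"
| Weak: "\<lbrakk>\<epsilon> \<in> rat01; \<epsilon>' \<in> rat01; \<epsilon> \<le> \<epsilon>'\<rbrakk> \<Longrightarrow> pf_rule \<tau> l {Apart x \<epsilon>' y} (Apart x \<epsilon> y)"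
| Lab: "l x \<noteq> l y \<Longrightarrow> pf_rule \<tau> l {} (Apart x 1 y)"
| Exp: "\<lbrakk>S = set_pmf (\<tau> x) \<union> set_pmf (\<tau> y); h ` S \<subseteq> rat01; \<epsilon> \<in> rat01; \<tau> x \<Turnstile> h - \<tau> y \<Turnstile> h \<ge> \<epsilon>\<rbrakk>
    \<Longrightarrow> pf_rule \<tau> l {Apart x' (h x' - h y') y' | x' y'. x' \<in> S \<and> y' \<in> S \<and> h x' > h y'} (Apart x \<epsilon> y)"

datatype 'x ptree = Node (root: "'x apartness") (subtrees: "'x ptree list")

inductive proof_tree :: "('x \<Rightarrow> 'x pmf) \<Rightarrow> ('x \<Rightarrow> 'l) \<Rightarrow> 'x ptree \<Rightarrow> bool"
  for \<tau> :: "'x \<Rightarrow> 'x pmf" and l :: "'x \<Rightarrow> 'l" where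
  "\<lbrakk>pf_rule \<tau> l (root ` set ts) j; \<forall>t\<in>set ts. proof_tree \<tau> l t\<rbrakk> \<Longrightarrow> proof_tree \<tau> l (Node j ts)"

end

theory Submission imports Defs
begin

text \<open>Let \<open>D x y\<close> be the supremum of the derivable indices. Derivations are sound for every
  pseudometric \<open>d\<close> with \<open>\<Gamma> d \<le> d\<close>, because maps on a finite set extend non-expansively. Conversely
  a non-expansive map can be approximated on a finite set by rational maps whose increments are strictly
  smaller, so \<open>\<Gamma> d \<le> D\<close> for every pseudometric \<open>d \<le> D\<close>. Let \<open>m\<close> be the supremum of these
  pseudometrics. Then \<open>\<Gamma> m\<close> is one of them, so \<open>\<Gamma> m \<le> m\<close>, and soundness gives \<open>D \<le> m\<close>. Hence
  \<open>D = m\<close> is a pseudometric with \<open>\<Gamma> D \<le> D\<close>; as \<open>\<Gamma> D\<close> is then also pre-fixed, soundness yields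
  \<open>D \<le> \<Gamma> D\<close>. Thus \<open>D\<close> is a fixed point, and by soundness the least one.\<close>

section \<open>Elementary consequences of the definitions\<close>

lemma rat01_iff: "r \<in> rat01 \<longleftrightarrow> 0 \<le> r \<and> r \<le> 1 \<and> r \<in> \<rat>"
  by (auto simp: rat01_def)

lemma PMetD:
  assumes "d \<in> PMet"
  shows "0 \<le> d x y" "d x y \<le> 1" "d x x = 0" "d x y = d y x" "d x z \<le> d x y + d y z"
  using assms unfolding PMet_def by auto

lemma nonexpansiveD:
  assumes "h \<in> nonexpansive d"
  shows "0 \<le> h u" "h u \<le> 1" "\<bar>h u - h v\<bar> \<le> d u v"
  using assms unfolding nonexpansive_def by auto

section \<open>Expectations\<close>

lemma expect_const: "finite (set_pmf \<mu>) \<Longrightarrow> \<mu> \<Turnstile> (\<lambda>_. c) = c"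
  unfolding expect_def by (simp add: sum_distrib_right[symmetric] sum_pmf_eq_1)

lemma expect_mono:
  "(\<And>u. u \<in> set_pmf \<mu> \<Longrightarrow> h u \<le> k u) \<Longrightarrow> \<mu> \<Turnstile> h \<le> \<mu> \<Turnstile> k"
  unfolding expect_def by (intro sum_mono mult_left_mono) auto

lemma expect_cong:
  "(\<And>u. u \<in> set_pmf \<mu> \<Longrightarrow> h u = k u) \<Longrightarrow> \<mu> \<Turnstile> h = \<mu> \<Turnstile> k"
  unfolding expect_def by (intro sum.cong) auto

lemma expect_diff: "\<mu> \<Turnstile> (\<lambda>u. h u - k u) = \<mu> \<Turnstile> h - \<mu> \<Turnstile> k"
  unfolding expect_def by (simp add: right_diff_distrib sum_subtractf)

lemma expect_bounds:
  assumes "finite (set_pmf \<mu>)" "\<And>u. u \<in> set_pmf \<mu> \<Longrightarrow> 0 \<le> h u \<and> h u \<le> 1"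
  shows "0 \<le> \<mu> \<Turnstile> h" "\<mu> \<Turnstile> h \<le> 1"
  using expect_mono[of \<mu> "\<lambda>_. 0" h] expect_mono[of \<mu> h "\<lambda>_. 1"] assms
  by (simp_all add: expect_const)

lemma tendsto_expect:
  "(\<And>u. (\<lambda>n. h n u) \<longlonglongrightarrow> k u) \<Longrightarrow> (\<lambda>n. \<mu> \<Turnstile> h n) \<longlonglongrightarrow> \<mu> \<Turnstile> k"
  unfolding expect_def by (intro tendsto_intros)

section \<open>The operator on pseudometrics\<close>

lemma expect_diff_le_1:
  assumes "\<And>z. finite (set_pmf (\<tau> z))" "h \<in> nonexpansive d"
  shows "\<tau> x \<Turnstile> h - \<tau> y \<Turnstile> h \<le> 1"
  using expect_bounds[OF assms(1), of x h] expect_bounds[OF assms(1), of y h]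
    nonexpansiveD[OF assms(2)] by fastforce

lemma bdd_above_expect_diff:
  assumes "\<And>z. finite (set_pmf (\<tau> z))"
  shows "bdd_above ((\<lambda>h. \<tau> x \<Turnstile> h - \<tau> y \<Turnstile> h) ` nonexpansive d)"
  using expect_diff_le_1[of \<tau>, OF assms] by (intro bdd_aboveI2[where M=1]) auto

lemma zero_nonexpansive: "d \<in> PMet \<Longrightarrow> (\<lambda>_. 0) \<in> nonexpansive d"
  unfolding nonexpansive_def by (auto simp: PMetD)

lemma \<Gamma>_upper:
  assumes "\<And>z. finite (set_pmf (\<tau> z))" "h \<in> nonexpansive d" "l x = l y"
  shows "\<tau> x \<Turnstile> h - \<tau> y \<Turnstile> h \<le> \<Gamma> \<tau> l d x y"
  using cSUP_upper[OF assms(2) bdd_above_expect_diff[of \<tau>, OF assms(1), of x y]] assms(3)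
  by (simp add: \<Gamma>_def)

text \<open>The zero map keeps the supremum from ranging over the empty set; this is where
  \<open>d \<in> PMet\<close> enters.\<close>

lemma \<Gamma>_least:
  assumes "d \<in> PMet" "l x \<noteq> l y \<Longrightarrow> 1 \<le> b"
    and "\<And>h. l x = l y \<Longrightarrow> h \<in> nonexpansive d \<Longrightarrow> \<tau> x \<Turnstile> h - \<tau> y \<Turnstile> h \<le> b"
  shows "\<Gamma> \<tau> l d x y \<le> b"
  using assms zero_nonexpansive[OF assms(1)] by (auto simp: \<Gamma>_def intro!: cSUP_least)

text \<open>Enlarging \<open>d\<close> relaxes the constraint on test maps, so the supremum runs
  over a larger set.\<close>

lemma \<Gamma>_mono:
  assumes "\<And>z. finite (set_pmf (\<tau> z))" "d \<in> PMet" "d \<le> d'"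
  shows "\<Gamma> \<tau> l d \<le> \<Gamma> \<tau> l d'"
proof (intro le_funI \<Gamma>_least[OF assms(2)])
  fix x y h
  assume "l x = l y" "h \<in> nonexpansive d"
  moreover have "nonexpansive d \<subseteq> nonexpansive d'"
    using assms(3) unfolding nonexpansive_def le_fun_def by (blast intro: order_trans)
  ultimately show "\<tau> x \<Turnstile> h - \<tau> y \<Turnstile> h \<le> \<Gamma> \<tau> l d' x y"
    using \<Gamma>_upper[of \<tau>, OF assms(1)] by blast
qed (simp add: \<Gamma>_def)

lemma \<Gamma>_PMet:
  assumes fin: "\<And>z. finite (set_pmf (\<tau> z))" and d: "d \<in> PMet"
  shows "\<Gamma> \<tau> l d \<in> PMet"
proof -
  let ?G = "\<Gamma> \<tau> l d"
  have nonneg: "0 \<le> ?G x y" for x y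
    using \<Gamma>_upper[of \<tau>, OF fin zero_nonexpansive[OF d], of l x y]
    by (cases "l x = l y") (auto simp: expect_const fin \<Gamma>_def)
  have le1: "?G x y \<le> 1" for x y
    by (rule \<Gamma>_least[OF d]) (auto intro: expect_diff_le_1 fin)
  have refl: "?G x x \<le> 0" for x
    by (rule \<Gamma>_least[OF d]) auto
  have symm: "?G x y \<le> ?G y x" for x y
  proof (rule \<Gamma>_least[OF d])
    fix h assume l: "l x = l y" and h: "h \<in> nonexpansive d"
    \<comment> \<open>Reflection in \<open>[0,1]\<close> reverses the sign of the difference of
      expectations while keeping values in range.\<close>
    have "(\<lambda>u. 1 - h u) \<in> nonexpansive d"
      using h unfolding nonexpansive_def by (auto simp: abs_minus_commute PMetD(4)[OF d])
    from \<Gamma>_upper[of \<tau>, OF fin this l[symmetric]]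
    show "\<tau> x \<Turnstile> h - \<tau> y \<Turnstile> h \<le> ?G y x"
      by (simp add: expect_diff expect_const fin)
  qed (simp add: \<Gamma>_def)
  have tri: "?G x z \<le> ?G x y + ?G y z" for x y z
  proof (cases "l x = l y \<and> l y = l z")
    case True
    show ?thesis
    proof (rule \<Gamma>_least[OF d])
      fix h assume h: "h \<in> nonexpansive d"
      show "\<tau> x \<Turnstile> h - \<tau> z \<Turnstile> h \<le> ?G x y + ?G y z"
        using \<Gamma>_upper[of \<tau>, OF fin h, of l x y] \<Gamma>_upper[of \<tau>, OF fin h, of l y z] True by simp
    qed (use True in simp)
  next
    case False
    \<comment> \<open>If the three labels do not all agree, one summand already attains the maximal
      distance 1.\<close>
    then have "?G x y = 1 \<or> ?G y z = 1"
      by (auto simp: \<Gamma>_def)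
    then show ?thesis
      using le1[of x z] nonneg[of x y] nonneg[of y z] by linarith
  qed
  show ?thesis
    unfolding PMet_def mem_Collect_eq atLeastAtMost_iff
    by (intro conjI allI nonneg le1 tri antisym[OF refl nonneg] antisym[OF symm symm])
qed

lemma SUP_PMet:
  assumes "K \<subseteq> PMet" "K \<noteq> {}"
  shows "(\<lambda>x y. SUP d\<in>K. d x y) \<in> PMet"
proof -
  let ?m = "\<lambda>x y. SUP d\<in>K. d x y"
  have K: "d \<in> PMet" if "d \<in> K" for d
    using assms(1) that by blast
  have upper: "d x y \<le> ?m x y" if "d \<in> K" for d x y
    using that PMetD(2)[OF K] by (intro cSUP_upper bdd_aboveI2[where M=1])
  obtain d0 where d0: "d0 \<in> K"
    using assms(2) by blast
  have nonneg: "0 \<le> ?m x y" for x y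
    by (rule order_trans[OF PMetD(1)[OF K[OF d0]] upper[OF d0]])
  have le1: "?m x y \<le> 1" for x y
    by (intro cSUP_least assms(2) PMetD(2)[OF K])
  have refl: "?m x x \<le> 0" for x
    by (intro cSUP_least assms(2) eq_refl PMetD(3)[OF K])
  have symm: "?m x y = ?m y x" for x y
    by (intro SUP_cong HOL.refl PMetD(4)[OF K])
  have tri: "?m x z \<le> ?m x y + ?m y z" for x y z
    by (intro cSUP_least assms(2) order_trans[OF PMetD(5)[OF K, where y=y] add_mono] upper)
  show ?thesis
    unfolding PMet_def mem_Collect_eq atLeastAtMost_iff
    by (intro conjI allI nonneg le1 tri antisym[OF refl nonneg]) (rule symm)
qed

section \<open>Soundness of derivations\<close>

text \<open>McShane extension: take the maximum of the maps \<open>h s - d s u\<close> over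
  \<open>s \<in> S\<close>, cut off below at 0 to stay in \<open>[0,1]\<close>.\<close>

lemma nonexpansive_extension:
  assumes d: "d \<in> PMet" and S: "finite S" "S \<noteq> {}"
    and h: "\<And>u. u \<in> S \<Longrightarrow> 0 \<le> h u \<and> h u \<le> 1"
    and ne: "\<And>u v. u \<in> S \<Longrightarrow> v \<in> S \<Longrightarrow> h u - h v \<le> d u v"
  obtains H where "H \<in> nonexpansive d" "\<And>u. u \<in> S \<Longrightarrow> H u = h u"
proof -
  define H where "H u = Max (insert 0 ((\<lambda>s. h s - d s u) ` S))" for u
  \<comment> \<open>Upper bounds on the maximum become pointwise checks, and \<open>b = H u\<close>
    returns the lower bounds.\<close>
  have H_le: "H u \<le> b \<longleftrightarrow> 0 \<le> b \<and> (\<forall>s\<in>S. h s - d s u \<le> b)" for u b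
    unfolding H_def using S by simp
  have H_ge: "0 \<le> H u" "s \<in> S \<Longrightarrow> h s - d s u \<le> H u" for u s
    using H_le[of u "H u"] by auto
  have "H u \<le> H v + d u v" for u v
  proof -
    have "h s - d s u \<le> H v + d u v" if "s \<in> S" for s
      using H_ge(2)[OF that, of v] PMetD(5)[OF d, of s v u] PMetD(4)[OF d, of u v] by linarith
    then show ?thesis
      unfolding H_le using H_ge(1)[of v] PMetD(1)[OF d, of u v] by auto
  qed
  note diff = this
  have "\<bar>H u - H v\<bar> \<le> d u v" for u v
    using diff[of u v] diff[of v u] PMetD(4)[OF d, of u v] by linarith
  moreover have "H u \<le> 1" for u
    unfolding H_le using h PMetD(1)[OF d, of _ u] by (fastforce intro: diff_le_eq[THEN iffD2] add_increasing2)
  ultimately have "H \<in> nonexpansive d"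
    unfolding nonexpansive_def using H_ge(1) by auto
  moreover have "H u = h u" if u: "u \<in> S" for u
  proof (rule antisym)
    show "H u \<le> h u"
      unfolding H_le using h[OF u] ne[OF _ u] by (auto simp: algebra_simps)
    show "h u \<le> H u"
      using H_ge(2)[OF u, of u] PMetD(3)[OF d] by simp
  qed
  ultimately show thesis
    by (rule that)
qed

text \<open>Induction on the tree. In the case of (exp) with equal labels, the premises make
  \<open>h\<close> non-expansive on the supports; its extension to all states is then a test map for
  \<open>\<Gamma> \<tau> l d x y\<close>.\<close>

lemma proof_tree_sound:
  assumes fin: "\<And>z. finite (set_pmf (\<tau> z))" and d: "d \<in> PMet" and pre: "\<Gamma> \<tau> l d \<le> d"
    and "proof_tree \<tau> l t" "root t = Apart x \<epsilon> y"
  shows "\<epsilon> \<in> rat01 \<and> \<epsilon> \<le> d x y"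
  using assms(4,5)
proof (induction arbitrary: x \<epsilon> y rule: proof_tree.induct)
  case (1 ts j)
  have le_d: "\<Gamma> \<tau> l d x y \<le> d x y"
    using pre by (simp add: le_fun_def)
  have IH: "e \<le> d u v" if j: "Apart u e v \<in> root ` set ts" for u e v
  proof -
    obtain t where "t \<in> set ts" "Apart u e v = root t"
      using j by blast
    then show ?thesis
      using 1(2) by (metis (no_types, lifting))
  qed
  from 1(1) have "pf_rule \<tau> l (root ` set ts) (Apart x \<epsilon> y)"
    using 1(3) by simp
  then show ?case
  proof cases
    case Zero
    then show ?thesis using PMetD(1)[OF d] by (simp add: rat01_iff)
  next
    case Symm
    then show ?thesis using IH[of y \<epsilon> x] PMetD(4)[OF d, of x y] by simp
  next
    case (Weak \<epsilon>')
    then show ?thesis using IH[of x \<epsilon>' y] by simp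
  next
    case Lab
    then show ?thesis using le_d by (simp add: rat01_iff \<Gamma>_def)
  next
    case (Exp S h)
    show ?thesis
    proof (cases "l x = l y")
      case True
      have "h u - h v \<le> d u v" if "u \<in> S" "v \<in> S" for u v
      \<comment> \<open>Premises exist for positive increments only; all others are below
        \<open>d\<close> because \<open>d\<close> is nonnegative.\<close>
      proof (cases "h u > h v")
        case True
        then have "Apart u (h u - h v) v \<in> root ` set ts"
          unfolding Exp(1) using that by blast
        then show ?thesis
          by (rule IH)
      next
        case False
        then show ?thesis using PMetD(1)[OF d, of u v] by linarith
      qed
      moreover have "finite S" "S \<noteq> {}"
        using fin Exp by (auto simp: set_pmf_not_empty)
      moreover have "0 \<le> h u \<and> h u \<le> 1" if "u \<in> S" for u
        using that Exp by (auto simp: rat01_iff)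
      ultimately obtain H where H: "H \<in> nonexpansive d" "\<And>u. u \<in> S \<Longrightarrow> H u = h u"
        using nonexpansive_extension[OF d, of S h] by metis
      have "\<tau> x \<Turnstile> H = \<tau> x \<Turnstile> h" "\<tau> y \<Turnstile> H = \<tau> y \<Turnstile> h"
        using H(2) Exp by (auto intro: expect_cong)
      then show ?thesis
        using \<Gamma>_upper[of \<tau>, OF fin H(1) True] le_d Exp by linarith
    next
      case False
      then show ?thesis
        using le_d Exp by (simp add: \<Gamma>_def rat01_iff)
    qed
  qed
qed

section \<open>The supremum of the derivable indices\<close>

definition provable :: "('x \<Rightarrow> 'x pmf) \<Rightarrow> ('x \<Rightarrow> 'l) \<Rightarrow> 'x apartness \<Rightarrow> bool" where
  "provable \<tau> l j \<longleftrightarrow> (\<exists>t. proof_tree \<tau> l t \<and> root t = j)"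

definition provable_dist :: "('x \<Rightarrow> 'x pmf) \<Rightarrow> ('x \<Rightarrow> 'l) \<Rightarrow> 'x \<Rightarrow> 'x \<Rightarrow> real" where
  "provable_dist \<tau> l x y = (SUP \<epsilon>\<in>{\<epsilon>. provable \<tau> l (Apart x \<epsilon> y)}. \<epsilon>)"

text \<open>Choose one tree per premise and list them. Finiteness of \<open>P\<close> is needed
  because a node stores its subtrees in a list.\<close>

lemma provable_step:
  assumes "pf_rule \<tau> l P j" "finite P" "\<And>p. p \<in> P \<Longrightarrow> provable \<tau> l p"
  shows "provable \<tau> l j"
proof -
  obtain ps where ps: "set ps = P"
    using assms(2) finite_list by blast
  obtain f where f: "\<And>p. p \<in> P \<Longrightarrow> proof_tree \<tau> l (f p) \<and> root (f p) = p"
    using assms(3) unfolding provable_def by metis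
  have "root ` set (map f ps) = P"
    using ps f by force
  then have "proof_tree \<tau> l (Node j (map f ps))"
    using assms(1) f ps by (intro proof_tree.intros) auto
  then show ?thesis
    unfolding provable_def by (metis ptree.sel(1))
qed

lemma provable_zero: "provable \<tau> l (Apart x 0 y)"
  by (rule provable_step[OF pf_rule.Zero]) auto

lemma provable_sound:
  assumes "\<And>z. finite (set_pmf (\<tau> z))" "d \<in> PMet" "\<Gamma> \<tau> l d \<le> d" "provable \<tau> l (Apart x \<epsilon> y)"
  shows "\<epsilon> \<in> rat01" "\<epsilon> \<le> d x y"
  using proof_tree_sound[OF assms(1-3)] assms(4) unfolding provable_def by auto

lemma discrete_PMet: "(\<lambda>x y. if x = y then 0 else 1) \<in> PMet"
  unfolding PMet_def by auto

text \<open>Soundness asks for some pre-fixed pseudometric. The discrete one is the greatest element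
  of \<open>PMet\<close>, hence pre-fixed.\<close>

lemma provable_rat01:
  assumes "\<And>z. finite (set_pmf (\<tau> z))" "provable \<tau> l (Apart x \<epsilon> y)"
  shows "\<epsilon> \<in> rat01"
proof (rule provable_sound(1)[OF assms(1) discrete_PMet _ assms(2)])
  let ?e = "\<lambda>x y. if x = y then 0 else 1 :: real"
  show "\<Gamma> \<tau> l ?e \<le> ?e"
    using PMetD(2,3)[OF \<Gamma>_PMet[of \<tau> _ l, OF assms(1) discrete_PMet]] by (auto simp: le_fun_def)
qed

lemma provable_dist_upper:
  assumes "\<And>z. finite (set_pmf (\<tau> z))" "provable \<tau> l (Apart x \<epsilon> y)"
  shows "\<epsilon> \<le> provable_dist \<tau> l x y"
  unfolding provable_dist_def
proof (rule cSUP_upper)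
  show "bdd_above ((\<lambda>\<epsilon>. \<epsilon>) ` {\<epsilon>. provable \<tau> l (Apart x \<epsilon> y)})"
    using provable_rat01[of \<tau> l, OF assms(1)] by (intro bdd_aboveI2[where M=1]) (simp add: rat01_iff)
qed (use assms in simp)

text \<open>Turns a strict bound on the supremum into an actual derivation; (zero) makes the set of
  indices nonempty.\<close>

lemma less_provable_distE:
  assumes "r < provable_dist \<tau> l x y"
  obtains \<epsilon> where "r < \<epsilon>" "provable \<tau> l (Apart x \<epsilon> y)"
proof -
  let ?E = "{\<epsilon>. provable \<tau> l (Apart x \<epsilon> y)}"
  have "?E \<noteq> {}"
    using provable_zero[of \<tau> l x y] by blast
  then have "\<exists>\<epsilon>\<in>?E. r < \<epsilon>"
    using assms unfolding provable_dist_def by (metis (no_types, lifting) cSUP_least not_le)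
  then show thesis
    using that by blast
qed

lemma provable_dist_le_prefixed:
  assumes "\<And>z. finite (set_pmf (\<tau> z))" "d \<in> PMet" "\<Gamma> \<tau> l d \<le> d"
  shows "provable_dist \<tau> l \<le> d"
proof (intro le_funI)
  fix x y
  show "provable_dist \<tau> l x y \<le> d x y"
    using less_provable_distE provable_sound(2)[OF assms] by (metis linorder_not_le)
qed

text \<open>The approximants have the form \<open>\<lfloor>n\<^sup>2 (1 - 1/n) h\<rfloor> / n\<^sup>2\<close>: shrinking by \<open>1 - 1/n\<close> absorbs
  the rounding error \<open>1/n\<^sup>2\<close> in every positive increment once \<open>1/n\<close> is below all positive increments
  of \<open>h\<close> on the finite set.\<close>

lemma rational_approximation:
  fixes h :: "'x \<Rightarrow> real"
  assumes S: "finite S" and h: "\<And>u. 0 \<le> h u \<and> h u \<le> 1"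
  obtains g :: "nat \<Rightarrow> 'x \<Rightarrow> real" where
    "\<And>u. (\<lambda>n. g n u) \<longlonglongrightarrow> h u" "\<And>n u. g n u \<in> rat01"
    "\<forall>\<^sub>F n in sequentially. \<forall>u\<in>S. \<forall>v\<in>S. g n u > g n v \<longrightarrow> g n u - g n v < h u - h v"
proof -
  define g where "g n u = of_int \<lfloor>(real n)\<^sup>2 * ((1 - 1 / real n) * h u)\<rfloor> / (real n)\<^sup>2" for n u
  have c: "0 \<le> 1 - 1 / real n" if "n > 0" for n
    using that by simp
  have g_le: "g n u \<le> (1 - 1 / real n) * h u"
    and g_gt: "(1 - 1 / real n) * h u - 1 / (real n)\<^sup>2 < g n u" if n: "n > 0" for n u
  proof -
    let ?z = "(1 - 1 / real n) * h u"
    have n2: "(real n)\<^sup>2 > 0" using n by simp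
    have "of_int \<lfloor>(real n)\<^sup>2 * ?z\<rfloor> \<le> (real n)\<^sup>2 * ?z" by simp
    then show "g n u \<le> ?z"
      unfolding g_def using n2 by (simp add: pos_divide_le_eq mult.commute)
    have "((real n)\<^sup>2 * ?z - 1) / (real n)\<^sup>2 < g n u"
      unfolding g_def by (rule divide_strict_right_mono[OF _ n2]) linarith
    then show "?z - 1 / (real n)\<^sup>2 < g n u"
      using n by (simp add: diff_divide_distrib)
  qed
  have lim: "(\<lambda>n. g n u) \<longlonglongrightarrow> h u" for u
  proof (rule tendsto_sandwich)
    \<comment> \<open>The error \<open>1/n^2\<close> is written as a product so that its limit
      follows from that of \<open>1/n\<close>.\<close>
    show "\<forall>\<^sub>F n in sequentially. (1 - 1 / real n) * h u - (1 / real n) * (1 / real n) \<le> g n u"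
      using eventually_gt_at_top[of 0]
      by eventually_elim (use g_gt in \<open>auto simp: power2_eq_square less_imp_le\<close>)
    show "\<forall>\<^sub>F n in sequentially. g n u \<le> (1 - 1 / real n) * h u"
      using eventually_gt_at_top[of 0] by eventually_elim (rule g_le)
    have "(\<lambda>n. (1 - 1 / real n) * h u - (1 / real n) * (1 / real n)) \<longlonglongrightarrow> (1 - 0) * h u - 0 * 0"
      by (intro tendsto_intros lim_1_over_n)
    then show "(\<lambda>n. (1 - 1 / real n) * h u - (1 / real n) * (1 / real n)) \<longlonglongrightarrow> h u" by simp
    have "(\<lambda>n. (1 - 1 / real n) * h u) \<longlonglongrightarrow> (1 - 0) * h u"
      by (intro tendsto_intros lim_1_over_n)
    then show "(\<lambda>n. (1 - 1 / real n) * h u) \<longlonglongrightarrow> h u" by simp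
  qed
  have rat: "g n u \<in> rat01" for n u
  proof (cases "n = 0")
    \<comment> \<open>Division by zero yields 0, so \<open>g 0 u = 0\<close>.\<close>
    case True
    then show ?thesis by (simp add: g_def rat01_iff)
  next
    case False
    then have n: "n > 0" by simp
    have "(1 - 1 / real n) * h u \<le> 1 * 1"
      by (rule mult_mono) (use h c[OF n] in auto)
    then have "g n u \<le> 1"
      using g_le[OF n, of u] by linarith
    moreover have "0 \<le> g n u"
      unfolding g_def using h c[OF n] by (simp add: zero_le_divide_iff)
    moreover have "g n u \<in> \<rat>"
      unfolding g_def by (intro Rats_divide Rats_of_int Rats_power Rats_of_nat)
    ultimately show ?thesis by (simp add: rat01_iff)
  qed
  have incr: "\<forall>\<^sub>F n in sequentially. g n u > g n v \<longrightarrow> g n u - g n v < h u - h v" for u v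
  proof (cases "h u > h v")
    case True
    have "\<forall>\<^sub>F n in sequentially. 1 / real n < h u - h v"
      by (rule order_tendstoD(2)[OF lim_1_over_n]) (use True in simp)
    then show ?thesis
      using eventually_gt_at_top[of 0]
    proof eventually_elim
      case (elim n)
      have "g n u - g n v < (1 - 1 / real n) * h u - ((1 - 1 / real n) * h v - 1 / (real n)\<^sup>2)"
        using g_le[OF elim(2), of u] g_gt[OF elim(2), of v] by linarith
      \<comment> \<open>The shrinkage is weighed against the rounding error: the bracket is positive
        because \<open>1/n\<close> is below the increment.\<close>
      also have "\<dots> = (h u - h v) - 1 / real n * ((h u - h v) - 1 / real n)"
        by (simp add: algebra_simps power2_eq_square)
      also have "\<dots> \<le> h u - h v"
        using elim by simp
      finally show ?case by simp
    qed
  next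
    case False
    show ?thesis
      using eventually_gt_at_top[of 0]
    proof eventually_elim
      case (elim n)
      \<comment> \<open>Rounding down is monotone, so \<open>g n\<close> has no positive increment
        where \<open>h\<close> has none.\<close>
      have "g n u \<le> g n v"
        unfolding g_def using False c[OF elim]
        by (intro divide_right_mono of_int_le_iff[THEN iffD2] floor_mono mult_left_mono) auto
      then show ?case by simp
    qed
  qed
  show thesis
    using that[OF lim rat] incr by (simp add: eventually_ball_finite S)
qed

section \<open>Completeness of the rules\<close>

text \<open>For equal labels, a rational \<open>\<epsilon>\<close> strictly between
  \<open>provable_dist\<close> and the value of a test map \<open>h\<close> would be derivable by
  (exp): a rational map close enough to \<open>h\<close> still exceeds \<open>\<epsilon>\<close>,
  and its positive increments are derivable.\<close>

lemma \<Gamma>_le_provable_dist: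
  assumes fin: "\<And>z. finite (set_pmf (\<tau> z))" and d: "d \<in> PMet" and le: "d \<le> provable_dist \<tau> l"
  shows "\<Gamma> \<tau> l d \<le> provable_dist \<tau> l"
proof (intro le_funI \<Gamma>_least[OF d])
  fix x y
  assume "l x \<noteq> l y"
  then have "provable \<tau> l (Apart x 1 y)"
    by (intro provable_step[OF pf_rule.Lab]) auto
  then show "1 \<le> provable_dist \<tau> l x y"
    by (rule provable_dist_upper[OF fin])
next
  fix x y h
  assume h: "h \<in> nonexpansive d"
  let ?S = "set_pmf (\<tau> x) \<union> set_pmf (\<tau> y)"
  have finS: "finite ?S" using fin by simp
  obtain g where g: "\<And>u. (\<lambda>n. g n u) \<longlonglongrightarrow> h u" "\<And>n u. g n u \<in> rat01"
    "\<forall>\<^sub>F n in sequentially. \<forall>u\<in>?S. \<forall>v\<in>?S. g n u > g n v \<longrightarrow> g n u - g n v < h u - h v"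
    using nonexpansiveD(1,2)[OF h] by (blast intro: rational_approximation[OF finS, of h])
  show "\<tau> x \<Turnstile> h - \<tau> y \<Turnstile> h \<le> provable_dist \<tau> l x y"
  proof (rule ccontr)
    assume "\<not> ?thesis"
    then obtain \<epsilon> where \<epsilon>: "\<epsilon> \<in> \<rat>" "provable_dist \<tau> l x y < \<epsilon>" "\<epsilon> < \<tau> x \<Turnstile> h - \<tau> y \<Turnstile> h"
      using Rats_dense_in_real by (metis not_le)
    have \<epsilon>01: "\<epsilon> \<in> rat01"
      using \<epsilon> expect_diff_le_1[of \<tau>, OF fin h, of x y]
        provable_dist_upper[of \<tau>, OF fin provable_zero, of l x y]
      by (simp add: rat01_iff)
    have "(\<lambda>n. \<tau> x \<Turnstile> g n - \<tau> y \<Turnstile> g n) \<longlonglongrightarrow> \<tau> x \<Turnstile> h - \<tau> y \<Turnstile> h"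
      by (intro tendsto_diff tendsto_expect g)
    then have "\<forall>\<^sub>F n in sequentially. \<epsilon> < \<tau> x \<Turnstile> g n - \<tau> y \<Turnstile> g n"
      using \<epsilon>(3) by (rule order_tendstoD(1))
    from eventually_happens[OF eventually_conj[OF this g(3)]] obtain n where
      n: "\<epsilon> < \<tau> x \<Turnstile> g n - \<tau> y \<Turnstile> g n"
        "\<And>u v. u \<in> ?S \<Longrightarrow> v \<in> ?S \<Longrightarrow> g n u > g n v \<Longrightarrow> g n u - g n v < h u - h v"
      by auto
    let ?P = "{Apart u (g n u - g n v) v | u v. u \<in> ?S \<and> v \<in> ?S \<and> g n u > g n v}"
    have "provable \<tau> l (Apart x \<epsilon> y)"
    proof (rule provable_step)
      show "pf_rule \<tau> l ?P (Apart x \<epsilon> y)"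
        using n(1) g(2) \<epsilon>01 by (intro pf_rule.Exp) auto
      have "?P \<subseteq> (\<lambda>(u, v). Apart u (g n u - g n v) v) ` (?S \<times> ?S)" by auto
      then show "finite ?P"
        by (rule finite_subset) (use finS in blast)
      fix p assume "p \<in> ?P"
      then obtain u v where p: "p = Apart u (g n u - g n v) v" "u \<in> ?S" "v \<in> ?S" "g n u > g n v"
        by blast
      let ?r = "g n u - g n v"
      have r: "?r \<in> rat01"
        using g(2)[of n u] g(2)[of n v] p(4) by (auto simp: rat01_iff)
      \<comment> \<open>Strictness is essential: the supremum \<open>provable_dist\<close> need not
        be attained, but anything strictly below it is exceeded by a derivable index, which (weak)
        lowers to \<open>?r\<close>.\<close>
      have "?r < h u - h v" using n(2) p by blast
      also have "\<dots> \<le> d u v" using nonexpansiveD(3)[OF h, of u v] by linarith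
      also have "\<dots> \<le> provable_dist \<tau> l u v" using le by (simp add: le_fun_def)
      finally obtain \<epsilon>' where "?r < \<epsilon>'" "provable \<tau> l (Apart u \<epsilon>' v)"
        by (rule less_provable_distE)
      then show "provable \<tau> l p"
        unfolding p(1) using r provable_rat01[OF fin]
        by (intro provable_step[OF pf_rule.Weak[of ?r \<epsilon>']]) auto
    qed
    then show False
      using provable_dist_upper[of \<tau>, OF fin] \<epsilon>(2) by fastforce
  qed
qed

section \<open>The supremum of derivable indices as least fixed point\<close>

text \<open>No rule composes judgments along a middle state, so the triangle inequality is not read
  off from derivations. It is inherited from \<open>m\<close>, the greatest pseudometric below
  \<open>?D\<close>, once both are shown equal.\<close>

lemma provable_dist_PMet:
  assumes fin: "\<And>z. finite (set_pmf (\<tau> z))"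
  shows "provable_dist \<tau> l \<in> PMet"
proof -
  let ?D = "provable_dist \<tau> l"
  define K where "K = {d \<in> PMet. d \<le> ?D}"
  define m where "m = (\<lambda>x y. SUP d\<in>K. d x y)"
  have "(\<lambda>_ _. 0) \<in> K"
    unfolding K_def PMet_def using provable_dist_upper[OF fin provable_zero]
    by (auto simp: le_fun_def)
  then have K: "K \<subseteq> PMet" "K \<noteq> {}"
    unfolding K_def by auto
  have m: "m \<in> PMet"
    unfolding m_def by (rule SUP_PMet[OF K])
  have "m \<le> ?D"
    unfolding m_def le_fun_def using K(2) by (auto intro!: cSUP_least simp: K_def le_fun_def)
  then have "\<Gamma> \<tau> l m \<in> K"
    unfolding K_def using \<Gamma>_PMet[of \<tau> m l, OF fin m] \<Gamma>_le_provable_dist[of \<tau> m l, OF fin m] by simp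
  then have "\<Gamma> \<tau> l m \<le> m"
    unfolding le_fun_def m_def[THEN fun_cong, THEN fun_cong]
    using K(1) by (intro allI cSUP_upper bdd_aboveI2[where M=1] PMetD(2)) auto
  then have "?D \<le> m"
    by (rule provable_dist_le_prefixed[OF fin m])
  with \<open>m \<le> ?D\<close> m show ?thesis
    by (simp add: antisym)
qed

lemma bd_eq_provable_dist:
  assumes fin: "\<And>z. finite (set_pmf (\<tau> z))"
  shows "bd \<tau> l = provable_dist \<tau> l"
proof -
  let ?D = "provable_dist \<tau> l"
  have D: "?D \<in> PMet"
    by (rule provable_dist_PMet[OF fin])
  have le: "\<Gamma> \<tau> l ?D \<le> ?D"
    by (rule \<Gamma>_le_provable_dist[OF fin D order_refl])
  have GD: "\<Gamma> \<tau> l ?D \<in> PMet"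
    by (rule \<Gamma>_PMet[OF fin D])
  have "?D \<le> \<Gamma> \<tau> l ?D"
    \<comment> \<open>Monotonicity applied to \<open>le\<close> makes
      \<open>\<Gamma> \<tau> l ?D\<close> pre-fixed too, as in the Knaster-Tarski argument.\<close>
    by (rule provable_dist_le_prefixed[OF fin GD \<Gamma>_mono[OF fin GD le]])
  then show ?thesis
    unfolding bd_def using D le
    \<comment> \<open>Every competing fixed point is in particular pre-fixed, so it lies above
      \<open>?D\<close>.\<close>
    by (intro Least_equality) (auto intro: provable_dist_le_prefixed[OF fin] antisym)
qed

theorem theorem13:
  fixes \<tau> :: "'x \<Rightarrow> 'x pmf" and l :: "'x \<Rightarrow> 'l" and x y :: 'x and \<delta> :: real
  assumes "\<And>z. \<tau> z \<in> rational_dists"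
    and "\<delta> > 0"
  shows "\<exists>\<epsilon>\<in>rat01. \<exists>t. proof_tree \<tau> l t \<and> root t = Apart x \<epsilon> y \<and>
           0 \<le> bd \<tau> l x y - \<epsilon> \<and> bd \<tau> l x y - \<epsilon> < \<delta>"
proof -
  have fin: "finite (set_pmf (\<tau> z))" for z
    using assms(1) by (simp add: rational_dists_def)
  have bd: "bd \<tau> l = provable_dist \<tau> l"
    by (rule bd_eq_provable_dist[OF fin])
  have "bd \<tau> l x y - \<delta> < provable_dist \<tau> l x y"
    using assms(2) bd by simp
  then obtain \<epsilon> where \<epsilon>: "bd \<tau> l x y - \<delta> < \<epsilon>" "provable \<tau> l (Apart x \<epsilon> y)"
    by (rule less_provable_distE)
  have "\<epsilon> \<in> rat01" "\<epsilon> \<le> bd \<tau> l x y"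
    using provable_rat01[OF fin \<epsilon>(2)] provable_dist_upper[OF fin \<epsilon>(2)] bd by simp_all
  then show ?thesis
    using \<epsilon> unfolding provable_def by force
qed

end
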